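(* Let $p(x)=x^n+a_{n-1}x^{n-1}+\cdots+a_1x+a_0$ be a monic complex polynomial of degree $n$ and let $b\in\{0,1,\ldots,n-2\}$. Let $F_b$ be any Fiedler companion matrix of $p$ (in Hessenberg form) such that $-a_b$ is in row $n$ but $-a_{b+1}$ is in row $n-1$. Then $\|L_b\|_\infty\le\|F_b\|_\infty$.
   Context: For an $n\times n$ complex matrix $A=[a_{ij}]$, $\|A\|_\infty=\max_i\sum_j|a_{ij}|$. A Fiedler companion matrix of $p$ (in Hessenberg form) is an $n\times n$ matrix with $1$ in each position $(i,i+1)$, $1\le i\le n-1$, in which each $-a_k$ ($0\le k\le n-1$) is placed in exactly one position, with $-a_0$ in position $(n,1)$ and such that, for $1\le k\le n-1$, if $-a_{k-1}$ is in position $(i,j)$ then $-a_k$ is in position $(i-1,j)$ or $(i,j+1)$; all other entries are $0$. (Thus $-a_k$ lies on the subdiagonal $i-j=n-1-k$.) Positions refer to the placement of the symbols; the coefficients themselves may be zero. For $0\le b\le n-1$, $L_b$ is the Fiedler companion matrix of $p$ with $1$ in each position $(i,i+1)$, $1\le i\le n-1$, with $-a_k$ in position $(n,k+1)$ for $0\le k\le b$, with $-a_k$ in position $(n-k+b,\,b+1)$ for $b+1\le k\le n-1$, and all other entries $0$. That is, $-a_0,\ldots,-a_b$ are in the last row and $-a_{b+1},\ldots,-a_{n-1}$ are stacked above $-a_b$ in column $b+1$. *)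

theory Defs
  imports Complex_Main "HOL-Computational_Algebra.Polynomial" "Jordan_Normal_Form.Matrix"
begin

definition mat_inf_norm :: "complex mat \<Rightarrow> real" where
  "mat_inf_norm A = Max ((\<lambda>i. \<Sum>j<dim_col A. cmod (A $$ (i, j))) ` {..<dim_row A})"

text \<open>
  A placement \<open>pos\<close> sends \<open>k < n\<close> to the position \<open>(i, j)\<close> of the symbol \<open>-a\<^sub>k\<close>; its values
  at \<open>k \<ge> n\<close> are irrelevant. Rows and columns of positions are counted from 1, whereas
  the entries of a \<open>mat\<close> are indexed from 0. The symbol \<open>-a\<^sub>k\<close> lies on the subdiagonal
  \<open>i - j = n - 1 - k\<close> (lemma \<open>fiedler_placement_bounds\<close>), so the truncated subtraction in
  \<open>i - 1\<close> is never applied to a row \<open>i \<le> 1\<close>.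
\<close>

definition fiedler_placement :: "nat \<Rightarrow> (nat \<Rightarrow> nat \<times> nat) \<Rightarrow> bool" where
  "fiedler_placement n pos \<longleftrightarrow>
     pos 0 = (n, 1) \<and>
     (\<forall>k\<in>{1..<n}. \<forall>i j. pos (k - 1) = (i, j) \<longrightarrow> pos k = (i - 1, j) \<or> pos k = (i, j + 1))"

definition fiedler_companion :: "complex poly \<Rightarrow> (nat \<Rightarrow> nat \<times> nat) \<Rightarrow> complex mat \<Rightarrow> bool" where
  "fiedler_companion p pos F \<longleftrightarrow>
     F \<in> carrier_mat (degree p) (degree p) \<and>
     fiedler_placement (degree p) pos \<and>
     (\<forall>i\<in>{1..degree p}. \<forall>j\<in>{1..degree p}.
        (j = i + 1 \<longrightarrow> F $$ (i - 1, j - 1) = 1) \<and>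
        (\<forall>k<degree p. pos k = (i, j) \<longrightarrow> F $$ (i - 1, j - 1) = - coeff p k) \<and>
        (j \<noteq> i + 1 \<and> (\<forall>k<degree p. pos k \<noteq> (i, j)) \<longrightarrow> F $$ (i - 1, j - 1) = 0))"

definition L_placement :: "nat \<Rightarrow> nat \<Rightarrow> nat \<Rightarrow> nat \<times> nat" where
  "L_placement n b k = (if k \<le> b then (n, k + 1) else (n - k + b, b + 1))"

text \<open>At most one \<open>k\<close> contributes to each of the sums below.\<close>

definition L_mat :: "complex poly \<Rightarrow> nat \<Rightarrow> complex mat" where
  "L_mat p b = mat (degree p) (degree p) (\<lambda>(r, c).
     if c = r + 1 then 1
     else \<Sum>k | k < degree p \<and> L_placement (degree p) b k = (r + 1, c + 1). - coeff p k)"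

lemma fiedler_placement_bounds:
  assumes "fiedler_placement n pos" "k < n" "pos k = (i, j)"
  shows "1 \<le> j" "j \<le> i" "i \<le> n" "i + k + 1 = n + j"
proof -
  have "1 \<le> j \<and> j \<le> i \<and> i \<le> n \<and> i + k + 1 = n + j"
    using assms(2,3)
  proof (induction k arbitrary: i j)
    case 0
    then show ?case using assms(1) by (auto simp: fiedler_placement_def)
  next
    case (Suc k)
    obtain i' j' where p: "pos k = (i', j')" by fastforce
    have "pos (Suc k) = (i' - 1, j') \<or> pos (Suc k) = (i', j' + 1)"
      using assms(1) Suc.prems(1) p
      unfolding fiedler_placement_def by (metis One_nat_def Suc_le_eq atLeastLessThan_iff diff_Suc_1 zero_less_Suc)
    then show ?case using Suc.IH[OF _ p] Suc.prems by auto
  qed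
  then show "1 \<le> j" "j \<le> i" "i \<le> n" "i + k + 1 = n + j" by auto
qed

lemma fiedler_placement_inj:
  assumes "fiedler_placement n pos" "k < n" "l < n" "pos k = pos l"
  shows "k = l"
  using fiedler_placement_bounds(4)[OF assms(1,2)] fiedler_placement_bounds(4)[OF assms(1,3)] assms(4)
  by (metis add_left_cancel add_right_cancel surj_pair)

lemma fiedler_placement_L:
  assumes "b < n"
  shows "fiedler_placement n (L_placement n b)"
  using assms by (auto simp: fiedler_placement_def L_placement_def)

lemma fiedler_companion_L_mat:
  assumes "b < degree p"
  shows "fiedler_companion p (L_placement (degree p) b) (L_mat p b)"
proof -
  note pl = fiedler_placement_L[OF assms]
  have ent: "L_mat p b $$ (i - 1, j - 1) = (if j = i + 1 then 1
     else \<Sum>k | k < degree p \<and> L_placement (degree p) b k = (i, j). - coeff p k)"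
    if "i \<in> {1..degree p}" "j \<in> {1..degree p}" for i j
    using that by (auto simp: L_mat_def)
  have single: "{k. k < degree p \<and> L_placement (degree p) b k = (i, j)} = {k}"
    if "k < degree p" "L_placement (degree p) b k = (i, j)" for i j k
    using that fiedler_placement_inj[OF pl] by auto
  have sub: "j \<noteq> i + 1" if "k < degree p" "L_placement (degree p) b k = (i, j)" for i j k
    using fiedler_placement_bounds(2)[OF pl that] by simp
  show ?thesis
    unfolding fiedler_companion_def
  proof (intro conjI ballI allI impI)
    show "L_mat p b \<in> carrier_mat (degree p) (degree p)" by (simp add: L_mat_def)
  next
    fix i j k assume "i \<in> {1..degree p}" "j \<in> {1..degree p}" "k < degree p"
      "L_placement (degree p) b k = (i, j)"
    then show "L_mat p b $$ (i - 1, j - 1) = - coeff p k"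
      using ent single sub by simp
  next
    fix i j assume a: "i \<in> {1..degree p}" "j \<in> {1..degree p}"
      "j \<noteq> i + 1 \<and> (\<forall>k<degree p. L_placement (degree p) b k \<noteq> (i, j))"
    then have "{k. k < degree p \<and> L_placement (degree p) b k = (i, j)} = {}" by auto
    then show "L_mat p b $$ (i - 1, j - 1) = 0"
      using ent[OF a(1,2)] a(3) by (simp only: sum.empty if_False)
  next
    fix i j assume a: "i \<in> {1..degree p}" "j \<in> {1..degree p}" "j = i + 1"
    show "L_mat p b $$ (i - 1, j - 1) = 1"
      using ent[OF a(1,2)] if_P[OF a(3)] by metis
  qed (rule pl)
qed

end

theory Submission
  imports Defs
begin

text \<open>
  A row of a Fiedler companion matrix has absolute sum \<open>\<Sum> \<bar>a\<^sub>k\<bar>\<close> over the symbols placed in it, plus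
  \<open>1\<close> unless it is the last row. Since the row of \<open>-a\<^sub>k\<close> is nonincreasing in \<open>k\<close>, the last rows of
  \<open>F\<^sub>b\<close> and \<open>L\<^sub>b\<close> both carry exactly \<open>-a\<^sub>0, \<dots>, -a\<^sub>b\<close>. Any other row of \<open>L\<^sub>b\<close> carries at most one
  symbol \<open>-a\<^sub>k\<close>, with \<open>k > b\<close>, and it is dominated by the row of \<open>F\<^sub>b\<close> containing that symbol.
\<close>

text \<open>Passing from one symbol to the next moves up a row or right within the same row, never
  down.\<close>

lemma fiedler_placement_row_antimono:
  assumes "fiedler_placement n pos" "k \<le> l" "l < n"
  shows "fst (pos l) \<le> fst (pos k)"
  using assms(2,3)
proof (induction l rule: dec_induct)
  case (step m)
  obtain i j where "pos m = (i, j)" by fastforce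
  moreover have "Suc m \<in> {1..<n}" using step.prems by simp
  ultimately have "pos (Suc m) = (i - 1, j) \<or> pos (Suc m) = (i, j + 1)"
    using assms(1) unfolding fiedler_placement_def by (metis diff_Suc_1)
  then have "fst (pos (Suc m)) \<le> fst (pos m)"
    using \<open>pos m = (i, j)\<close> by auto
  then show ?case using step by simp
qed simp

text \<open>Each entry is expanded as a sum over all symbols, of which injectivity of the placement
  leaves at most one; swapping the sums then counts each symbol of the row once.\<close>

lemma fiedler_companion_row_sum:
  assumes F: "fiedler_companion p pos F" and r: "r < degree p"
  shows "(\<Sum>c<degree p. cmod (F $$ (r, c))) =
    (if r + 1 < degree p then 1 else 0) +
    (\<Sum>k | k < degree p \<and> fst (pos k) = r + 1. cmod (coeff p k))"
proof -
  let ?n = "degree p"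
  have pl: "fiedler_placement ?n pos"
    using F by (simp add: fiedler_companion_def)
  have entry: "cmod (F $$ (r, c)) = (if c = r + 1 then 1 else 0) +
      (\<Sum>k<?n. if pos k = (r + 1, c + 1) then cmod (coeff p k) else 0)" if c: "c < ?n" for c
  proof -
    have "r + 1 \<in> {1..?n}" "c + 1 \<in> {1..?n}" using r c by auto
    with F have "(c + 1 = r + 1 + 1 \<longrightarrow> F $$ (r + 1 - 1, c + 1 - 1) = 1) \<and>
        (\<forall>k<?n. pos k = (r + 1, c + 1) \<longrightarrow> F $$ (r + 1 - 1, c + 1 - 1) = - coeff p k) \<and>
        (c + 1 \<noteq> r + 1 + 1 \<and> (\<forall>k<?n. pos k \<noteq> (r + 1, c + 1)) \<longrightarrow>
          F $$ (r + 1 - 1, c + 1 - 1) = 0)"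
      unfolding fiedler_companion_def by blast
    then have one: "c = r + 1 \<Longrightarrow> F $$ (r, c) = 1"
      and coef: "\<And>k. k < ?n \<Longrightarrow> pos k = (r + 1, c + 1) \<Longrightarrow> F $$ (r, c) = - coeff p k"
      and zero: "c \<noteq> r + 1 \<Longrightarrow> \<forall>k<?n. pos k \<noteq> (r + 1, c + 1) \<Longrightarrow> F $$ (r, c) = 0"
      by simp_all
    show ?thesis
    proof (cases "\<exists>k<?n. pos k = (r + 1, c + 1)")
      case True
      then obtain k where k: "k < ?n" "pos k = (r + 1, c + 1)" by blast
      have "(\<Sum>l<?n. if pos l = (r + 1, c + 1) then cmod (coeff p l) else 0) =
          (\<Sum>l<?n. if l = k then cmod (coeff p l) else 0)"
        using k by (intro sum.cong) (auto dest: fiedler_placement_inj[OF pl _ k(1)])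
      also have "\<dots> = cmod (coeff p k)" using k by simp
      \<comment> \<open>Symbols lie on or below the diagonal, so a position holding one is not
        superdiagonal and the leading \<open>1\<close> drops out.\<close>
      finally show ?thesis
        using coef[OF k] fiedler_placement_bounds(2)[OF pl k] by simp
    next
      case False
      then have "(\<Sum>l<?n. if pos l = (r + 1, c + 1) then cmod (coeff p l) else 0) = 0"
        by (intro sum.neutral) auto
      then show ?thesis using one zero False by auto
    qed
  qed
  \<comment> \<open>The bounds place \<open>j - 1\<close> among the columns
    \<open>0, ..., n - 1\<close>, so exactly one column is hit when the row matches.\<close>
  have col: "(\<Sum>c<?n. if pos k = (r + 1, c + 1) then cmod (coeff p k) else 0) =
      (if fst (pos k) = r + 1 then cmod (coeff p k) else 0)" if k: "k < ?n" for k
  proof -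
    obtain i j where ij: "pos k = (i, j)" by fastforce
    note b = fiedler_placement_bounds[OF pl k ij]
    have "(\<Sum>c<?n. if pos k = (r + 1, c + 1) then cmod (coeff p k) else 0) =
        (\<Sum>c<?n. if c = j - 1 then (if i = r + 1 then cmod (coeff p k) else 0) else 0)"
      using b ij by (intro sum.cong) auto
    also have "\<dots> = (if i = r + 1 then cmod (coeff p k) else 0)"
      using b by (subst sum.delta) auto
    finally show ?thesis using ij by simp
  qed
  have "(\<Sum>c<?n. cmod (F $$ (r, c))) = (\<Sum>c<?n. if c = r + 1 then 1 else 0) +
      (\<Sum>c<?n. \<Sum>k<?n. if pos k = (r + 1, c + 1) then cmod (coeff p k) else 0)"
    using entry by (simp add: sum.distrib)
  also have "(\<Sum>c<?n. if c = r + 1 then 1 else 0) = (if r + 1 < ?n then 1 else 0 :: real)"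
    by simp
  also have "(\<Sum>c<?n. \<Sum>k<?n. if pos k = (r + 1, c + 1) then cmod (coeff p k) else 0) =
      (\<Sum>k<?n. if fst (pos k) = r + 1 then cmod (coeff p k) else 0)"
    by (subst sum.swap, rule sum.cong, simp, rule col) simp
  also have "\<dots> = (\<Sum>k | k < ?n \<and> fst (pos k) = r + 1. cmod (coeff p k))"
    by (subst sum.inter_filter [symmetric]) (auto intro: sum.cong)
  finally show ?thesis .
qed

text \<open>As the norm is a maximum over rows, the dominating row may sit at another index, and
  several rows of \<open>A\<close> may share one.\<close>

lemma mat_inf_norm_mono:
  assumes "0 < dim_row A"
    and "\<And>i. i < dim_row A \<Longrightarrow> \<exists>i'<dim_row B.
      (\<Sum>j<dim_col A. cmod (A $$ (i, j))) \<le> (\<Sum>j<dim_col B. cmod (B $$ (i', j)))"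
  shows "mat_inf_norm A \<le> mat_inf_norm B"
  unfolding mat_inf_norm_def
proof (rule Max.boundedI)
  show "(\<lambda>i. \<Sum>j<dim_col A. cmod (A $$ (i, j))) ` {..<dim_row A} \<noteq> {}"
    using assms(1) by auto
next
  fix s assume "s \<in> (\<lambda>i. \<Sum>j<dim_col A. cmod (A $$ (i, j))) ` {..<dim_row A}"
  then obtain i' where "i' < dim_row B" "s \<le> (\<Sum>j<dim_col B. cmod (B $$ (i', j)))"
    using assms(2) by auto
  then show "s \<le> Max ((\<lambda>i. \<Sum>j<dim_col B. cmod (B $$ (i, j))) ` {..<dim_row B})"
    by (intro order_trans[OF _ Max_ge]) auto
qed simp

theorem theorem4p1:
  fixes p :: "complex poly" and n b :: nat and pos :: "nat \<Rightarrow> nat \<times> nat" and F :: "complex mat"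
  assumes "lead_coeff p = 1" and "degree p = n" and "n \<ge> 2"
    and "b \<in> {0..n - 2}"
    and "fiedler_companion p pos F"
    and "fst (pos b) = n" and "fst (pos (b + 1)) = n - 1"
  shows "mat_inf_norm (L_mat p b) \<le> mat_inf_norm F"
proof (rule mat_inf_norm_mono)
  let ?P = "L_placement n b"
  have b: "b + 1 < n" using assms(3,4) by auto
  have L: "fiedler_companion p ?P (L_mat p b)"
    using fiedler_companion_L_mat[of b p] assms(2) b by simp
  have pl: "fiedler_placement n pos" and dimF: "dim_row F = n" "dim_col F = n"
    using assms(2,5) by (auto simp: fiedler_companion_def)
  have dimL: "dim_row (L_mat p b) = n" "dim_col (L_mat p b) = n"
    using assms(2) by (simp_all add: L_mat_def)
  note sumF = fiedler_companion_row_sum[OF assms(5), unfolded assms(2)]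
  note sumL = fiedler_companion_row_sum[OF L, unfolded assms(2)]
  \<comment> \<open>Monotonicity up to \<open>b\<close> gives \<open>n\<close> as a lower bound for
    the row, and the placement bounds give it as an upper bound.\<close>
  have top: "fst (pos k) = n" if "k \<le> b" for k
    using fiedler_placement_row_antimono[OF pl that] assms(6) b
      fiedler_placement_bounds(3)[OF pl, of k "fst (pos k)" "snd (pos k)"] that by simp
  have low: "fst (pos k) < n" if "b < k" "k < n" for k
    using fiedler_placement_row_antimono[OF pl, of "b + 1" k] assms(7) b that by simp
  show "0 < dim_row (L_mat p b)" using dimL b by simp
  fix r assume "r < dim_row (L_mat p b)"
  then have r: "r < n" using dimL by simp
  let ?S = "{k. k < n \<and> fst (?P k) = r + 1}"
  have "\<exists>i<n. (\<Sum>j<n. cmod (L_mat p b $$ (r, j))) \<le> (\<Sum>j<n. cmod (F $$ (i, j)))"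
  proof (cases "r + 1 = n")
    case True
    have "?S = {..b}"
      using b True by (auto simp: L_placement_def split: if_splits)
    moreover have "{k. k < n \<and> fst (pos k) = r + 1} = {..b}"
      using b True top low by (fastforce simp: not_le[symmetric])
    ultimately show ?thesis using sumF[OF r] sumL[OF r] r by (intro exI[of _ r]) simp
  next
    case False
    show ?thesis
    proof (cases "?S = {}")
      \<comment> \<open>These are the rows above the stack in column \<open>b + 1\<close>: the
        superdiagonal \<open>1\<close> is their only nonzero entry, and the same row of
        \<open>F\<close> has it too.\<close>
      case True
      have "1 \<le> (\<Sum>j<n. cmod (F $$ (r, j)))"
        using sumF[OF r] False r by (simp add: sum_nonneg)
      moreover have "(\<Sum>j<n. cmod (L_mat p b $$ (r, j))) = 1"
        unfolding sumL[OF r] True using False r by simp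
      ultimately show ?thesis using r by auto
    next
      case ne: False
      then obtain k where k: "k < n" "fst (?P k) = r + 1" by blast
      have kb: "b < k" using k False by (auto simp: L_placement_def split: if_splits)
      \<comment> \<open>Beyond \<open>b\<close> the row \<open>n - k + b\<close> is strictly
        decreasing in \<open>k\<close>, so no other symbol shares it.\<close>
      have S: "?S = {k}"
        using k kb False by (auto simp: L_placement_def split: if_splits)
      \<comment> \<open>The zero-based row of \<open>F\<close> holding the symbol of
        \<open>k\<close>. By \<open>low\<close> it is not the last row, so it also carries the
        superdiagonal \<open>1\<close> needed to match \<open>1 + cmod (coeff p k)\<close>.\<close>
      define i where "i = fst (pos k) - 1"
      have "1 \<le> fst (pos k)"
        using fiedler_placement_bounds(1,2)[OF pl k(1), of "fst (pos k)" "snd (pos k)"] by simp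
      then have i: "i + 1 = fst (pos k)" "i + 1 < n"
        using low[OF kb k(1)] by (auto simp: i_def)
      have "cmod (coeff p k) \<le> (\<Sum>l | l < n \<and> fst (pos l) = i + 1. cmod (coeff p l))"
        using k i by (intro member_le_sum) auto
      moreover have "(\<Sum>j<n. cmod (L_mat p b $$ (r, j))) = 1 + cmod (coeff p k)"
        unfolding sumL[OF r] S using False r by simp
      ultimately show ?thesis
        using sumF[of i] i by (intro exI[of _ i]) simp
    qed
  qed
  then show "\<exists>i'<dim_row F. (\<Sum>j<dim_col (L_mat p b). cmod (L_mat p b $$ (r, j)))
      \<le> (\<Sum>j<dim_col F. cmod (F $$ (i', j)))"
    using dimF dimL by simp
qed

end
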